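(* Let $X$ be an implicative-orthomodular lattice, let $x\in X$, and for $z\in X$ denote $x_z=(z\to(z\to x^* )^* )\to(z^*\to x)^*$. The following hold: (1) $x_z\in\mathcal{K}(x)$ for every $z\in X$; (2) for any $y\in\mathcal{K}(x)$, there exists $z\in X$ such that $y=x_z$; (3) for every $z\in X$, $x_z=x^*$ if and only if $x\mathcal{C}z$.
   Context: A BE algebra is an algebra $(X,\to,1)$ of type $(2,0)$ such that for all $x,y,z\in X$: $x\to x=1$; $x\to 1=1$; $1\to x=x$; $x\to(y\to z)=y\to(x\to z)$. Write $x\le y$ iff $x\to y=1$. It is bounded if there is $0\in X$ with $0\le x$ for all $x\in X$; then $x^*:=x\to 0$. A bounded BE algebra is involutive if $x^{**}=x$ for all $x$. A BE algebra is implicative if $(x\to y)\to x=x$ for all $x,y$. In an involutive BE algebra put $x\Cap y:=((x^*\to y^* )\to y^* )^*$. An implicative-orthomodular lattice is an implicative involutive BE algebra satisfying $x\Cap(y\to x)=x$ for all $x,y$. An element $x$ commutes with $y$, written $x\mathcal{C}y$, if $x=(x\to y^* )\to(x\to y)^*$. For $x\in X$, $\mathcal{K}(x)=\{z\in X\mid x\to z^*=x^*\to z=1\}$ is the set of all complements of $x$. *)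

theory Defs
  imports Main
begin

locale be_algebra =
  fixes X :: "'a set"
    and imp :: "'a \<Rightarrow> 'a \<Rightarrow> 'a"  (infixr "\<leadsto>" 70)
    and one :: "'a"
  assumes imp_closed: "\<lbrakk>x \<in> X; y \<in> X\<rbrakk> \<Longrightarrow> x \<leadsto> y \<in> X"
    and one_closed: "one \<in> X"
    and imp_self: "x \<in> X \<Longrightarrow> x \<leadsto> x = one"
    and imp_one: "x \<in> X \<Longrightarrow> x \<leadsto> one = one"
    and one_imp: "x \<in> X \<Longrightarrow> one \<leadsto> x = x"
    and imp_exchange:
      "\<lbrakk>x \<in> X; y \<in> X; z \<in> X\<rbrakk> \<Longrightarrow> x \<leadsto> (y \<leadsto> z) = y \<leadsto> (x \<leadsto> z)"
begin

(* In general only a reflexive relation. In an implicative-orthomodular lattice, where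
   x \<leadsto> y plays the role of the join of the complement of x with y, it is
   not the lattice order. *)
definition le :: "'a \<Rightarrow> 'a \<Rightarrow> bool"  (infix "\<preceq>" 50)
  where "x \<preceq> y \<longleftrightarrow> x \<leadsto> y = one"

end

locale bounded_be_algebra = be_algebra X imp one
  for X :: "'a set" and imp (infixr "\<leadsto>" 70) and one +
  fixes zero :: "'a"
  assumes zero_closed: "zero \<in> X"
    and zero_le: "x \<in> X \<Longrightarrow> zero \<preceq> x"
begin

definition star :: "'a \<Rightarrow> 'a"  ("_\<^sup>*" [1000] 1000)
  where "x\<^sup>* = x \<leadsto> zero"

definition cap :: "'a \<Rightarrow> 'a \<Rightarrow> 'a"  (infixl "\<Cap>" 75)
  where "x \<Cap> y = ((x\<^sup>* \<leadsto> y\<^sup>*) \<leadsto> y\<^sup>*)\<^sup>*"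

definition commutes :: "'a \<Rightarrow> 'a \<Rightarrow> bool"
  where "commutes x y \<longleftrightarrow> x = (x \<leadsto> y\<^sup>*) \<leadsto> (x \<leadsto> y)\<^sup>*"

definition complements :: "'a \<Rightarrow> 'a set"
  where "complements x = {z \<in> X. x \<leadsto> z\<^sup>* = one \<and> x\<^sup>* \<leadsto> z = one}"

(* The element written x_z, for x and z in X. *)
definition complement_via :: "'a \<Rightarrow> 'a \<Rightarrow> 'a"
  where "complement_via x z = (z \<leadsto> (z \<leadsto> x\<^sup>*)\<^sup>*) \<leadsto> (z\<^sup>* \<leadsto> x)\<^sup>*"

end

locale involutive_be_algebra = bounded_be_algebra X imp one zero
  for X :: "'a set" and imp (infixr "\<leadsto>" 70) and one and zero +
  assumes star_star: "x \<in> X \<Longrightarrow> (x\<^sup>*)\<^sup>* = x"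

locale implicative_be_algebra = be_algebra X imp one
  for X :: "'a set" and imp (infixr "\<leadsto>" 70) and one +
  assumes implicative: "\<lbrakk>x \<in> X; y \<in> X\<rbrakk> \<Longrightarrow> (x \<leadsto> y) \<leadsto> x = x"

locale implicative_orthomodular_lattice =
  involutive_be_algebra X imp one zero + implicative_be_algebra X imp one
  for X :: "'a set" and imp (infixr "\<leadsto>" 70) and one and zero +
  assumes orthomodular: "\<lbrakk>x \<in> X; y \<in> X\<rbrakk> \<Longrightarrow> x \<Cap> (y \<leadsto> x) = x"

end

theory Submission
  imports Defs
begin

text \<open>
  With \<open>x \<squnion> y = x\<^sup>* \<leadsto> y\<close> and \<open>x \<sqinter> y = (x\<^sup>* \<squnion> y\<^sup>*)\<^sup>*\<close> the algebra is an orthomodular lattice,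
  where the implicative law is absorption. There
  \<open>x\<^sub>z = (z \<sqinter> (z \<sqinter> x)\<^sup>*) \<squnion> (z \<squnion> x)\<^sup>*\<close>: the relative complement of \<open>z \<sqinter> x\<close> in \<open>z\<close>, enlarged by
  \<open>(z \<squnion> x)\<^sup>*\<close>. The orthomodular law makes it a complement of \<open>x\<close>, every complement \<open>y\<close> of \<open>x\<close> equals
  \<open>x\<^sub>y\<close>, and both sides of the third equivalence amount to \<open>x \<sqsubseteq> z\<^sup>* \<squnion> (z \<sqinter> x)\<close>
  in the lattice order.
\<close>

text \<open>The notation for reflexive transitive closure would compete with
  \<open>x\<^sup>*\<close>.\<close>

unbundle no rtrancl_syntax

context implicative_orthomodular_lattice
begin

section \<open>Lattice operations and order\<close>

definition join :: "'a \<Rightarrow> 'a \<Rightarrow> 'a"  (infixl "\<squnion>" 65)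
  where "x \<squnion> y = x\<^sup>* \<leadsto> y"

definition meet :: "'a \<Rightarrow> 'a \<Rightarrow> 'a"  (infixl "\<sqinter>" 68)
  where "x \<sqinter> y = (x\<^sup>* \<squnion> y\<^sup>*)\<^sup>*"

text \<open>The order has to come from the join: \<open>x \<preceq> y\<close> only says
  \<open>x\<^sup>* \<squnion> y = one\<close>, which need not be transitive.\<close>

definition lattice_le :: "'a \<Rightarrow> 'a \<Rightarrow> bool"  (infix "\<sqsubseteq>" 50)
  where "x \<sqsubseteq> y \<longleftrightarrow> x \<squnion> y = y"

lemma star_closed [simp]: "x \<in> X \<Longrightarrow> x\<^sup>* \<in> X"
  by (simp add: star_def imp_closed zero_closed)

lemma join_closed [simp]: "\<lbrakk>x \<in> X; y \<in> X\<rbrakk> \<Longrightarrow> x \<squnion> y \<in> X"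
  by (simp add: join_def imp_closed)

lemma meet_closed [simp]: "\<lbrakk>x \<in> X; y \<in> X\<rbrakk> \<Longrightarrow> x \<sqinter> y \<in> X"
  by (simp add: meet_def)

declare star_star [simp] one_closed [simp] zero_closed [simp]

lemma star_one [simp]: "one\<^sup>* = zero"
  by (simp add: star_def one_imp)

lemma star_eq_iff: "\<lbrakk>x \<in> X; y \<in> X\<rbrakk> \<Longrightarrow> x\<^sup>* = y\<^sup>* \<longleftrightarrow> x = y"
  by (metis star_star)

lemma star_zero [simp]: "zero\<^sup>* = one"
  by (simp add: star_def imp_self)

lemma imp_eq_join: "x \<in> X \<Longrightarrow> x \<leadsto> y = x\<^sup>* \<squnion> y"
  by (simp add: join_def)

text \<open>Writing \<open>x\<close> and \<open>y\<close> as double stars turns both sides into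
  iterated implications ending in \<open>zero\<close>, and exchange swaps the premises
  \<open>x\<^sup>*\<close> and \<open>y\<^sup>*\<close>.\<close>

lemma join_commute: "\<lbrakk>x \<in> X; y \<in> X\<rbrakk> \<Longrightarrow> x \<squnion> y = y \<squnion> x"
  using imp_exchange[of "x\<^sup>*" "y\<^sup>*" zero] star_star[of x] star_star[of y]
  by (simp add: join_def flip: star_def)

lemma join_left_commute:
  "\<lbrakk>x \<in> X; y \<in> X; z \<in> X\<rbrakk> \<Longrightarrow> x \<squnion> (y \<squnion> z) = y \<squnion> (x \<squnion> z)"
  by (simp add: join_def imp_exchange)

lemma join_assoc: "\<lbrakk>x \<in> X; y \<in> X; z \<in> X\<rbrakk> \<Longrightarrow> x \<squnion> y \<squnion> z = x \<squnion> (y \<squnion> z)"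
  by (metis join_closed join_commute join_left_commute)

lemma star_join: "\<lbrakk>x \<in> X; y \<in> X\<rbrakk> \<Longrightarrow> (x \<squnion> y)\<^sup>* = x\<^sup>* \<sqinter> y\<^sup>*"
  by (simp add: meet_def)

lemma star_meet: "\<lbrakk>x \<in> X; y \<in> X\<rbrakk> \<Longrightarrow> (x \<sqinter> y)\<^sup>* = x\<^sup>* \<squnion> y\<^sup>*"
  by (simp add: meet_def)

lemma meet_commute: "\<lbrakk>x \<in> X; y \<in> X\<rbrakk> \<Longrightarrow> x \<sqinter> y = y \<sqinter> x"
  by (simp add: meet_def join_commute)

lemma join_star_self: "x \<in> X \<Longrightarrow> x \<squnion> x\<^sup>* = one"
  by (simp add: join_def imp_self)

lemma meet_star_self: "x \<in> X \<Longrightarrow> x \<sqinter> x\<^sup>* = zero"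
  by (metis join_commute join_star_self meet_def star_closed star_one star_star)

lemma zero_join: "x \<in> X \<Longrightarrow> zero \<squnion> x = x"
  by (simp add: join_def one_imp)

lemma join_zero: "x \<in> X \<Longrightarrow> x \<squnion> zero = x"
  using join_commute[of x zero] by (simp add: zero_join)

lemma le_zero_eq: "\<lbrakk>x \<sqsubseteq> zero; x \<in> X\<rbrakk> \<Longrightarrow> x = zero"
  by (simp add: lattice_le_def join_zero)

lemma meet_le1: "\<lbrakk>x \<in> X; y \<in> X\<rbrakk> \<Longrightarrow> x \<sqinter> y \<sqsubseteq> x"
  using implicative[of x "y\<^sup>*"]
  by (simp add: lattice_le_def imp_eq_join imp_closed meet_def)

lemma meet_le2: "\<lbrakk>x \<in> X; y \<in> X\<rbrakk> \<Longrightarrow> x \<sqinter> y \<sqsubseteq> y"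
  by (metis meet_commute meet_le1)

lemma join_idem: "x \<in> X \<Longrightarrow> x \<squnion> x = x"
  using implicative[of x zero] by (simp add: join_def flip: star_def)

lemma le_trans: "\<lbrakk>x \<sqsubseteq> y; y \<sqsubseteq> z; x \<in> X; y \<in> X; z \<in> X\<rbrakk> \<Longrightarrow> x \<sqsubseteq> z"
  by (metis join_assoc lattice_le_def)

lemma le_antisym: "\<lbrakk>x \<sqsubseteq> y; y \<sqsubseteq> x; x \<in> X; y \<in> X\<rbrakk> \<Longrightarrow> x = y"
  by (metis join_commute lattice_le_def)

lemma le_join1: "\<lbrakk>x \<in> X; y \<in> X\<rbrakk> \<Longrightarrow> x \<sqsubseteq> x \<squnion> y"
  by (metis join_assoc join_idem lattice_le_def)

lemma le_join2: "\<lbrakk>x \<in> X; y \<in> X\<rbrakk> \<Longrightarrow> y \<sqsubseteq> x \<squnion> y"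
  by (metis join_commute le_join1)

lemma join_least: "\<lbrakk>x \<sqsubseteq> z; y \<sqsubseteq> z; x \<in> X; y \<in> X; z \<in> X\<rbrakk> \<Longrightarrow> x \<squnion> y \<sqsubseteq> z"
  by (metis join_assoc lattice_le_def)

lemma star_antimono:
  assumes "x \<sqsubseteq> y" "x \<in> X" "y \<in> X"
  shows "y\<^sup>* \<sqsubseteq> x\<^sup>*"
proof -
  have "y\<^sup>* = x\<^sup>* \<sqinter> y\<^sup>*"
    using assms star_join[of x y] by (simp add: lattice_le_def)
  then show ?thesis
    using meet_le1[of "x\<^sup>*" "y\<^sup>*"] assms by simp
qed

lemma star_le_star_iff: "\<lbrakk>x \<in> X; y \<in> X\<rbrakk> \<Longrightarrow> y\<^sup>* \<sqsubseteq> x\<^sup>* \<longleftrightarrow> x \<sqsubseteq> y"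
  by (metis star_antimono star_closed star_star)

lemma meet_greatest: "\<lbrakk>z \<sqsubseteq> x; z \<sqsubseteq> y; x \<in> X; y \<in> X; z \<in> X\<rbrakk> \<Longrightarrow> z \<sqsubseteq> x \<sqinter> y"
  using star_le_star_iff[of z "x \<sqinter> y"] by (simp add: star_meet join_least star_antimono)

section \<open>The orthomodular law in lattice form\<close>

lemma cap_eq_meet: "\<lbrakk>x \<in> X; y \<in> X\<rbrakk> \<Longrightarrow> x \<Cap> y = (x \<squnion> y\<^sup>*) \<sqinter> y"
  by (simp add: cap_def imp_eq_join imp_closed meet_def)

text \<open>This is the axiom at \<open>x\<close> and \<open>y\<^sup>*\<close>: when
  \<open>x \<sqsubseteq> y\<close>, the implication \<open>y\<^sup>* \<leadsto> x\<close> collapses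
  to \<open>y\<close>.\<close>

lemma orthomodular_meet:
  assumes "x \<sqsubseteq> y" "x \<in> X" "y \<in> X"
  shows "y \<sqinter> (x \<squnion> y\<^sup>*) = x"
proof -
  have "y\<^sup>* \<leadsto> x = y"
    using assms by (metis join_commute join_def lattice_le_def)
  with orthomodular[of x "y\<^sup>*"] assms show ?thesis
    by (simp add: cap_eq_meet meet_commute)
qed

text \<open>The dual form, obtained by starring the previous law for
  \<open>y\<^sup>* \<sqsubseteq> x\<^sup>*\<close>.\<close>

lemma orthomodular_join:
  assumes "x \<sqsubseteq> y" "x \<in> X" "y \<in> X"
  shows "x \<squnion> (y \<sqinter> x\<^sup>*) = y"
proof -
  have "(x\<^sup>* \<sqinter> (y\<^sup>* \<squnion> x))\<^sup>* = y"
    using orthomodular_meet[of "y\<^sup>*" "x\<^sup>*"] assms by (simp add: star_antimono)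
  then show ?thesis
    using assms by (simp add: star_meet star_join)
qed

section \<open>Commutation and complements in lattice terms\<close>

lemma commutes_eq:
  "\<lbrakk>x \<in> X; z \<in> X\<rbrakk> \<Longrightarrow> commutes x z \<longleftrightarrow> x = (x \<sqinter> z) \<squnion> (x \<sqinter> z\<^sup>*)"
  by (simp add: commutes_def imp_eq_join imp_closed meet_def)

lemma mem_complements_iff:
  assumes "x \<in> X"
  shows "y \<in> complements x \<longleftrightarrow> y \<in> X \<and> x \<sqinter> y = zero \<and> x \<squnion> y = one"
proof -
  have "x \<sqinter> y = zero \<longleftrightarrow> x \<leadsto> y\<^sup>* = one" if "y \<in> X"
    using that assms star_eq_iff[of "x\<^sup>* \<squnion> y\<^sup>*" one] by (simp add: meet_def imp_eq_join)
  then show ?thesis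
    using assms by (auto simp: complements_def join_def)
qed

lemma complement_via_eq:
  "\<lbrakk>x \<in> X; z \<in> X\<rbrakk> \<Longrightarrow> complement_via x z = (z \<sqinter> (z \<sqinter> x)\<^sup>*) \<squnion> (z \<squnion> x)\<^sup>*"
  by (simp add: complement_via_def imp_eq_join imp_closed meet_def)

text \<open>Joining \<open>a\<close> to \<open>x\<close> already gives \<open>b\<close>, so
  \<open>b\<^sup>*\<close> completes the join to \<open>one\<close>. For the meet, orthomodularity
  forces every common lower bound of \<open>x\<close> and \<open>a \<squnion> b\<^sup>*\<close>
  below \<open>a\<close>, hence below both \<open>z \<sqinter> x\<close> and its star.\<close>

lemma complement_via_in_complements:
  assumes x: "x \<in> X" and z: "z \<in> X"
  shows "complement_via x z \<in> complements x"
proof -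
  define a b where "a = z \<sqinter> (z \<sqinter> x)\<^sup>*" and "b = z \<squnion> x"
  have ab [simp]: "a \<in> X" "b \<in> X"
    using x z by (simp_all add: a_def b_def)
  have via: "complement_via x z = a \<squnion> b\<^sup>*"
    using x z by (simp add: complement_via_eq a_def b_def)
  have "z \<sqinter> x \<squnion> a = z"
    using orthomodular_join[OF meet_le1] x z by (simp add: a_def)
  moreover have "x \<squnion> z \<sqinter> x = x"
    using x z meet_le2[of z x] by (simp add: lattice_le_def join_commute[of x])
  ultimately have "x \<squnion> a = x \<squnion> z"
    using join_assoc[of x "z \<sqinter> x" a] x z by simp
  then have "x \<squnion> (a \<squnion> b\<^sup>*) = b \<squnion> b\<^sup>*"
    using join_assoc[of x a "b\<^sup>*"] x z by (simp add: b_def join_commute)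
  then have join: "x \<squnion> (a \<squnion> b\<^sup>*) = one"
    by (simp add: join_star_self)
  have "a \<sqsubseteq> z" "a \<sqsubseteq> (z \<sqinter> x)\<^sup>*"
    using x z by (simp_all add: a_def meet_le1 meet_le2)
  have "z \<sqsubseteq> b" "x \<sqsubseteq> b"
    using x z by (simp_all add: b_def le_join1 le_join2)
  have "a \<sqsubseteq> b"
    by (rule le_trans[OF \<open>a \<sqsubseteq> z\<close> \<open>z \<sqsubseteq> b\<close>]) (simp_all add: z)
  \<comment> \<open>Meeting with \<open>b\<close> removes the summand \<open>b\<^sup>*\<close>; no
    distributivity is available, only the orthomodular law for
    \<open>a \<sqsubseteq> b\<close>.\<close>
  then have ba: "b \<sqinter> (a \<squnion> b\<^sup>*) = a"
    by (simp add: orthomodular_meet)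
  define w where "w = x \<sqinter> (a \<squnion> b\<^sup>*)"
  have w [simp]: "w \<in> X" and "w \<sqsubseteq> x" "w \<sqsubseteq> a \<squnion> b\<^sup>*"
    using x by (simp_all add: w_def meet_le1 meet_le2)
  have "w \<sqsubseteq> b"
    by (rule le_trans[OF \<open>w \<sqsubseteq> x\<close> \<open>x \<sqsubseteq> b\<close>]) (simp_all add: x)
  then have "w \<sqsubseteq> a"
    using meet_greatest[OF _ \<open>w \<sqsubseteq> a \<squnion> b\<^sup>*\<close>, of b] by (simp add: ba)
  have "w \<sqsubseteq> z"
    by (rule le_trans[OF \<open>w \<sqsubseteq> a\<close> \<open>a \<sqsubseteq> z\<close>]) (simp_all add: z)
  then have "w \<sqsubseteq> z \<sqinter> x"
    using \<open>w \<sqsubseteq> x\<close> x z by (simp add: meet_greatest)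
  moreover have "w \<sqsubseteq> (z \<sqinter> x)\<^sup>*"
    by (rule le_trans[OF \<open>w \<sqsubseteq> a\<close> \<open>a \<sqsubseteq> (z \<sqinter> x)\<^sup>*\<close>]) (simp_all add: x z)
  ultimately have "w \<sqsubseteq> zero"
    using meet_greatest[of w "z \<sqinter> x" "(z \<sqinter> x)\<^sup>*"] x z by (simp add: meet_star_self)
  then have "x \<sqinter> (a \<squnion> b\<^sup>*) = zero"
    by (simp add: le_zero_eq flip: w_def)
  with join via x show ?thesis
    by (simp add: mem_complements_iff)
qed

text \<open>For a complement \<open>y\<close> the inner meet is \<open>zero\<close> and the inner
  join is \<open>one\<close>, so the formula reduces to
  \<open>(y \<sqinter> one) \<squnion> zero\<close>.\<close>

lemma complement_via_complement:
  assumes "x \<in> X" and "y \<in> complements x"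
  shows "complement_via x y = y"
proof -
  have y: "y \<in> X" "y \<sqinter> x = zero" "y \<squnion> x = one"
    using assms by (simp_all add: mem_complements_iff meet_commute join_commute)
  have "y \<sqinter> one = y"
    using y by (simp add: meet_def join_zero)
  then show ?thesis
    using assms(1) y by (simp add: complement_via_eq join_zero)
qed

text \<open>Orthomodularity splits \<open>x\<^sup>*\<close> into \<open>y\<close> and
  \<open>x\<^sup>* \<sqinter> y\<^sup>*\<close>; the second part is the star of
  \<open>x \<squnion> y = one\<close>.\<close>

lemma complement_le_star_eq:
  assumes "x \<in> X" "y \<in> complements x" "y \<sqsubseteq> x\<^sup>*"
  shows "y = x\<^sup>*"
proof -
  have y: "y \<in> X" "x \<squnion> y = one"
    using assms by (simp_all add: mem_complements_iff)
  have "y \<squnion> (x\<^sup>* \<sqinter> y\<^sup>*) = x\<^sup>*"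
    using orthomodular_join[of y "x\<^sup>*"] assms y by simp
  moreover have "x\<^sup>* \<sqinter> y\<^sup>* = zero"
    using assms(1) y by (simp flip: star_join)
  ultimately show ?thesis
    using y by (simp add: join_zero)
qed

lemma commutes_iff_le:
  assumes x: "x \<in> X" and z: "z \<in> X"
  shows "commutes x z \<longleftrightarrow> x \<sqsubseteq> z\<^sup>* \<squnion> (z \<sqinter> x)"
proof
  assume "commutes x z"
  then have "x = (x \<sqinter> z) \<squnion> (x \<sqinter> z\<^sup>*)"
    using x z by (simp add: commutes_eq)
  moreover have "x \<sqinter> z \<sqsubseteq> z\<^sup>* \<squnion> (z \<sqinter> x)"
    using x z by (simp add: le_join2 meet_commute)
  moreover have "x \<sqinter> z\<^sup>* \<sqsubseteq> z\<^sup>* \<squnion> (z \<sqinter> x)"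
    by (rule le_trans[OF meet_le2 le_join1]) (simp_all add: x z)
  ultimately show "x \<sqsubseteq> z\<^sup>* \<squnion> (z \<sqinter> x)"
    using x z join_least[of "x \<sqinter> z" "z\<^sup>* \<squnion> (z \<sqinter> x)" "x \<sqinter> z\<^sup>*"] by simp
next
  assume le: "x \<sqsubseteq> z\<^sup>* \<squnion> (z \<sqinter> x)"
  define c where "c = x \<sqinter> z"
  have c [simp]: "c \<in> X" and "c \<sqsubseteq> x" "c \<sqsubseteq> z" and cz: "z \<sqinter> x = c"
    using x z by (simp_all add: c_def meet_le1 meet_le2 meet_commute)
  \<comment> \<open>\<open>d\<close> is the relative complement of \<open>c\<close> in
    \<open>x\<close>. For commutation it suffices that \<open>d\<close> lies below
    \<open>z\<^sup>*\<close>.\<close>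
  define d where "d = x \<sqinter> c\<^sup>*"
  have d [simp]: "d \<in> X" and "d \<sqsubseteq> x" "d \<sqsubseteq> c\<^sup>*"
    using x by (simp_all add: d_def meet_le1 meet_le2)
  have split: "c \<squnion> d = x"
    using orthomodular_join[OF \<open>c \<sqsubseteq> x\<close>] x by (simp add: d_def)
  \<comment> \<open>Orthomodularity for \<open>z\<^sup>* \<sqsubseteq> c\<^sup>*\<close>: an element
    below both \<open>c\<^sup>*\<close> and \<open>z\<^sup>* \<squnion> c\<close> is below
    \<open>z\<^sup>*\<close>.\<close>
  have "c\<^sup>* \<sqinter> (z\<^sup>* \<squnion> c) = z\<^sup>*"
    using orthomodular_meet[of "z\<^sup>*" "c\<^sup>*"] z \<open>c \<sqsubseteq> z\<close> by (simp add: star_antimono)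
  moreover have "d \<sqsubseteq> z\<^sup>* \<squnion> c"
    by (rule le_trans[OF \<open>d \<sqsubseteq> x\<close> le[unfolded cz]]) (simp_all add: x z)
  ultimately have "d \<sqsubseteq> z\<^sup>*"
    using z \<open>d \<sqsubseteq> c\<^sup>*\<close> meet_greatest[of d "c\<^sup>*" "z\<^sup>* \<squnion> c"] by simp
  then have "d \<sqsubseteq> x \<sqinter> z\<^sup>*"
    using x z \<open>d \<sqsubseteq> x\<close> by (simp add: meet_greatest)
  have "d \<sqsubseteq> c \<squnion> (x \<sqinter> z\<^sup>*)"
    by (rule le_trans[OF \<open>d \<sqsubseteq> x \<sqinter> z\<^sup>*\<close> le_join2]) (simp_all add: x z)
  then have "c \<squnion> d \<sqsubseteq> c \<squnion> (x \<sqinter> z\<^sup>*)"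
    using x z by (simp add: join_least le_join1)
  moreover have "c \<squnion> (x \<sqinter> z\<^sup>*) \<sqsubseteq> x"
    using x z \<open>c \<sqsubseteq> x\<close> by (simp add: join_least meet_le1)
  ultimately have "x = c \<squnion> (x \<sqinter> z\<^sup>*)"
    using x z by (intro le_antisym) (simp_all add: split)
  then show "commutes x z"
    using x z by (simp add: commutes_eq c_def)
qed

text \<open>A complement of \<open>x\<close> below \<open>x\<^sup>*\<close> equals it, so the
  equation is an inequality. The summand \<open>(z \<squnion> x)\<^sup>*\<close> satisfies it
  always; for \<open>a\<close> it dualises to \<open>x \<sqsubseteq> a\<^sup>*\<close>, the
  criterion for commutation.\<close>

lemma complement_via_eq_star_iff:
  assumes x: "x \<in> X" and z: "z \<in> X"
  shows "complement_via x z = x\<^sup>* \<longleftrightarrow> commutes x z"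
proof -
  define a where "a = z \<sqinter> (z \<sqinter> x)\<^sup>*"
  have a [simp]: "a \<in> X" and via: "complement_via x z = a \<squnion> (z \<squnion> x)\<^sup>*"
    using x z by (simp_all add: a_def complement_via_eq)
  have a_star: "a\<^sup>* = z\<^sup>* \<squnion> (z \<sqinter> x)"
    using x z star_meet[of z "(z \<sqinter> x)\<^sup>*"] by (simp add: a_def)
  have "(z \<squnion> x)\<^sup>* \<sqsubseteq> x\<^sup>*"
    using x z by (simp add: star_antimono le_join2)
  then have "complement_via x z = x\<^sup>* \<longleftrightarrow> a \<sqsubseteq> x\<^sup>*"
    using x z complement_le_star_eq[OF x complement_via_in_complements[OF x z]]
      join_least[of a "x\<^sup>*" "(z \<squnion> x)\<^sup>*"] le_join1[of a "(z \<squnion> x)\<^sup>*"]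
    by (auto simp: via)
  also have "\<dots> \<longleftrightarrow> x \<sqsubseteq> z\<^sup>* \<squnion> (z \<sqinter> x)"
    using x star_le_star_iff[of x "a\<^sup>*"] by (simp flip: a_star)
  finally show ?thesis
    using x z by (simp add: commutes_iff_le)
qed

end

theorem theorem5p6:
  fixes X :: "'a set" and imp :: "'a \<Rightarrow> 'a \<Rightarrow> 'a" and one zero x :: 'a
  assumes "implicative_orthomodular_lattice X imp one zero"
    and "x \<in> X"
  shows "(\<forall>z\<in>X. bounded_be_algebra.complement_via imp zero x z
              \<in> bounded_be_algebra.complements X imp one zero x)
    \<and> (\<forall>y\<in>bounded_be_algebra.complements X imp one zero x.
          \<exists>z\<in>X. y = bounded_be_algebra.complement_via imp zero x z)
    \<and> (\<forall>z\<in>X. bounded_be_algebra.complement_via imp zero x z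
                = bounded_be_algebra.star imp zero x
            \<longleftrightarrow> bounded_be_algebra.commutes imp zero x z)"
proof -
  interpret implicative_orthomodular_lattice X imp one zero
    by (fact assms(1))
  \<comment> \<open>The witness is \<open>y\<close> itself.\<close>
  have "\<exists>z\<in>X. y = complement_via x z" if "y \<in> complements x" for y
    using that assms(2) complement_via_complement by (metis mem_complements_iff)
  then show ?thesis
    using assms(2) by (simp add: complement_via_in_complements complement_via_eq_star_iff)
qed

end
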